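(* Type 3 NG-graphs are not NGD-graphs. That is, if $G$ is an NG-graph such that $G[A_G]$ is a 5-cycle, then $G$ is not an NGD-graph.
   Context: Graphs are finite and simple. $\overline{G}$ is the complement of $G$, $\chi$ the chromatic number, and $G[S]$ the subgraph induced by $S$. A coloring of $V(G)$ is distinguishing if the only automorphism of $G$ preserving all vertex colors is the identity; $D(G)$ is the minimum number of colors in a distinguishing coloring of $G$, and $\chi_D(G)$ is the minimum number of colors in a coloring of $G$ that is both proper and distinguishing. With $n=|V(G)|$, $G$ is an NG-graph if $\chi(G)+\chi(\overline{G})=n+1$, and an NGD-graph if $\chi_D(G)+\chi_D(\overline{G})=n+D(G)$. For an NG-graph $G$, $A_G=\{v\in V(G):\deg(v)=\chi(G)-1\}$; $G$ is of Type 3 if $G[A_G]$ is a 5-cycle. *)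

theory Defs
  imports "Graph_Theory.Graph_Theory"
begin

text \<open>
  A finite simple graph is a \<open>pair_graph\<close>: a finite vertex set \<open>pverts G\<close> with a symmetric
  irreflexive arc relation \<open>parcs G\<close>, each edge appearing as two opposite arcs. Hence the degree of
  a vertex is its \<open>out_degree\<close>. Isomorphisms and induced subgraphs are defined in the library for
  \<open>pre_digraph\<close>, into which \<open>with_proj\<close> embeds pair graphs.
\<close>

definition complement_graph :: "'a pair_pre_digraph \<Rightarrow> 'a pair_pre_digraph" where
  "complement_graph G =
     \<lparr> pverts = pverts G,
       parcs = {(u, v). u \<in> pverts G \<and> v \<in> pverts G \<and> u \<noteq> v \<and> (u, v) \<notin> parcs G} \<rparr>"

definition cycle_graph :: "nat \<Rightarrow> nat pair_pre_digraph" where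
  "cycle_graph n =
     \<lparr> pverts = {..<n},
       parcs = {(i, j). i < n \<and> j < n \<and> (j = (i + 1) mod n \<or> i = (j + 1) mod n)} \<rparr>"

text \<open>
  The library's isomorphisms also carry a map on arcs; an automorphism is the vertex part of an
  isomorphism from \<open>G\<close> to \<open>G\<close>. The values of \<open>f\<close> outside \<open>pverts G\<close> are irrelevant. See
  \<open>graph_automorphism_iff\<close> below for the description by vertices alone.
\<close>

definition graph_automorphism :: "'a pair_pre_digraph \<Rightarrow> ('a \<Rightarrow> 'a) \<Rightarrow> bool" where
  "graph_automorphism G f \<longleftrightarrow>
     (\<exists>hom. pre_digraph.digraph_isomorphism (with_proj G) hom \<and>
            app_iso hom (with_proj G) = with_proj G \<and> iso_verts hom = f)"

text \<open>
  A coloring with at most \<open>k\<close> colors has its values in \<open>{..<k}\<close>; not all of them need occur, which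
  does not affect the minimum number of colors.
\<close>

definition vertex_coloring :: "'a pair_pre_digraph \<Rightarrow> nat \<Rightarrow> ('a \<Rightarrow> nat) \<Rightarrow> bool" where
  "vertex_coloring G k c \<longleftrightarrow> (\<forall>v \<in> pverts G. c v < k)"

definition proper_coloring :: "'a pair_pre_digraph \<Rightarrow> ('a \<Rightarrow> nat) \<Rightarrow> bool" where
  "proper_coloring G c \<longleftrightarrow> (\<forall>(u, v) \<in> parcs G. c u \<noteq> c v)"

definition distinguishing_coloring :: "'a pair_pre_digraph \<Rightarrow> ('a \<Rightarrow> nat) \<Rightarrow> bool" where
  "distinguishing_coloring G c \<longleftrightarrow>
     (\<forall>f. graph_automorphism G f \<longrightarrow> (\<forall>v \<in> pverts G. c (f v) = c v) \<longrightarrow> (\<forall>v \<in> pverts G. f v = v))"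

definition chromatic_number :: "'a pair_pre_digraph \<Rightarrow> nat" where
  "chromatic_number G = (LEAST k. \<exists>c. vertex_coloring G k c \<and> proper_coloring G c)"

definition distinguishing_number :: "'a pair_pre_digraph \<Rightarrow> nat" where
  "distinguishing_number G = (LEAST k. \<exists>c. vertex_coloring G k c \<and> distinguishing_coloring G c)"

definition distinguishing_chromatic_number :: "'a pair_pre_digraph \<Rightarrow> nat" where
  "distinguishing_chromatic_number G =
     (LEAST k. \<exists>c. vertex_coloring G k c \<and> proper_coloring G c \<and> distinguishing_coloring G c)"

definition NG_graph :: "'a pair_pre_digraph \<Rightarrow> bool" where
  "NG_graph G \<longleftrightarrow>
     chromatic_number G + chromatic_number (complement_graph G) = card (pverts G) + 1"

definition NGD_graph :: "'a pair_pre_digraph \<Rightarrow> bool" where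
  "NGD_graph G \<longleftrightarrow>
     distinguishing_chromatic_number G + distinguishing_chromatic_number (complement_graph G)
       = card (pverts G) + distinguishing_number G"

text \<open>
  The natural subtraction does not truncate: a graph with a vertex has chromatic number at least 1.
\<close>

definition A_set :: "'a pair_pre_digraph \<Rightarrow> 'a set" where
  "A_set G = {v \<in> pverts G. out_degree (with_proj G) v = chromatic_number G - 1}"

definition type_3 :: "'a pair_pre_digraph \<Rightarrow> bool" where
  "type_3 G \<longleftrightarrow> digraph_iso (with_proj G \<restriction> A_set G) (with_proj (cycle_graph 5))"

lemma pair_graph_complement_graph:
  assumes "pair_graph G"
  shows "pair_graph (complement_graph G)"
proof -
  interpret pair_graph G by (rule assms)
  have "finite {(u, v). u \<in> pverts G \<and> v \<in> pverts G \<and> u \<noteq> v \<and> (u, v) \<notin> parcs G}"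
    by (rule finite_subset[of _ "pverts G \<times> pverts G"]) auto
  moreover have "(u, v) \<in> parcs G \<longleftrightarrow> (v, u) \<in> parcs G" for u v
    by (metis arcs_symmetric)
  ultimately show ?thesis
    using pair_finite_verts
    by unfold_locales (auto simp: complement_graph_def symmetric_def sym_def)
qed

lemma pair_graph_cycle_graph:
  assumes "n \<ge> 3"
  shows "pair_graph (cycle_graph n)"
proof -
  have "Suc i mod n \<noteq> i" if "i < n" for i
  proof (cases "Suc i = n")
    case True
    then show ?thesis using assms by simp
  next
    case False
    then show ?thesis using that by simp
  qed
  then have loopfree: "u \<noteq> v" if "(u, v) \<in> parcs (cycle_graph n)" for u v
    using that by (simp add: cycle_graph_def) metis
  show ?thesis
  proof
    show "finite (pverts (cycle_graph n))" by (simp add: cycle_graph_def)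
    show "finite (parcs (cycle_graph n))"
      by (rule finite_subset[of _ "{..<n} \<times> {..<n}"]) (auto simp: cycle_graph_def)
    show "symmetric (with_proj (cycle_graph n))"
      unfolding symmetric_def with_proj_simps by (rule symI) (simp add: cycle_graph_def, blast)
    fix e assume e: "e \<in> parcs (cycle_graph n)"
    then show "fst e \<in> pverts (cycle_graph n)" "snd e \<in> pverts (cycle_graph n)"
      by (auto simp: cycle_graph_def)
    show "fst e \<noteq> snd e" using e loopfree[of "fst e" "snd e"] by simp
  qed
qed

lemma graph_automorphism_iff:
  assumes "pair_graph G"
  shows "graph_automorphism G f \<longleftrightarrow>
    bij_betw f (pverts G) (pverts G) \<and>
    (\<forall>u \<in> pverts G. \<forall>v \<in> pverts G. (u, v) \<in> parcs G \<longleftrightarrow> (f u, f v) \<in> parcs G)"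
    (is "?L \<longleftrightarrow> ?R")
proof -
  interpret pair_graph G by (rule assms)
  show ?thesis
  proof
    assume ?L
    then obtain hom where h: "digraph_isomorphism hom"
      and app: "app_iso hom (with_proj G) = with_proj G" and f: "iso_verts hom = f"
      unfolding graph_automorphism_def by blast
    have V: "f ` pverts G = pverts G" and E: "iso_arcs hom ` parcs G = parcs G"
      and "iso_tail hom = fst" "iso_head hom = snd"
      using app f by (auto simp: app_iso_def with_proj_def)
    then have arc: "iso_arcs hom a = (f (fst a), f (snd a))" if "a \<in> parcs G" for a
      using h f that unfolding digraph_isomorphism_def by (auto intro: prod_eqI)
    have inj: "inj_on f (pverts G)" using h f unfolding digraph_isomorphism_def by auto
    have "(u, v) \<in> parcs G \<longleftrightarrow> (f u, f v) \<in> parcs G" if "u \<in> pverts G" "v \<in> pverts G" for u v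
    proof
      assume "(u, v) \<in> parcs G"
      then show "(f u, f v) \<in> parcs G" using arc E by force
    next
      assume "(f u, f v) \<in> parcs G"
      then obtain a where a: "a \<in> parcs G" "(f u, f v) = iso_arcs hom a" using E by force
      then have "f u = f (fst a)" "f v = f (snd a)" using arc by auto
      then have "u = fst a" "v = snd a"
        using inj that a(1) arc_fst_in_verts arc_snd_in_verts by (meson inj_onD)+
      then show "(u, v) \<in> parcs G" using a by simp
    qed
    then show ?R using V inj by (auto simp: bij_betw_def)
  next
    assume R: ?R
    define hom where "hom = \<lparr> iso_verts = f, iso_arcs = map_prod f f, iso_head = snd, iso_tail = fst \<rparr>"
    have V: "f ` pverts G = pverts G" and inj: "inj_on f (pverts G)"
      using R by (auto simp: bij_betw_def)
    have sub: "parcs G \<subseteq> pverts G \<times> pverts G" by (auto dest: wellformed')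
    have "inj_on (map_prod f f) (parcs G)"
      by (rule inj_on_subset[OF map_prod_inj_on[OF inj inj] sub])
    then have 1: "digraph_isomorphism hom"
      using inj wf_digraph_axioms unfolding digraph_isomorphism_def hom_def by auto
    have "map_prod f f ` parcs G = parcs G"
    proof
      show "map_prod f f ` parcs G \<subseteq> parcs G" using R sub by auto
      show "parcs G \<subseteq> map_prod f f ` parcs G"
      proof (rule subrelI)
        fix x y assume xy: "(x, y) \<in> parcs G"
        then have "x \<in> f ` pverts G" "y \<in> f ` pverts G" using V sub by auto
        then obtain u v where uv: "u \<in> pverts G" "v \<in> pverts G" "x = f u" "y = f v"
          by (elim imageE)
        then have "(u, v) \<in> parcs G" using xy R by simp
        then have "map_prod f f (u, v) \<in> map_prod f f ` parcs G" by (rule imageI)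
        then show "(x, y) \<in> map_prod f f ` parcs G" using uv by simp
      qed
    qed
    with V have 2: "app_iso hom (with_proj G) = with_proj G"
      unfolding app_iso_def hom_def with_proj_def by simp
    show ?L unfolding graph_automorphism_def using 1 2 by (auto simp: hom_def)
  qed
qed

end

theory Submission
  imports Defs
begin

text \<open>
  Let \<open>A = A_set G\<close>, let \<open>B\<close> and \<open>C\<close> be the sets of vertices of degree above and below
  \<open>\<chi>(G) - 1\<close>, and write \<open>b = |B|\<close>, \<open>c = |C|\<close> and \<open>n = 5 + b + c\<close>.
  Passing to the complement keeps \<open>A\<close>, which again induces a 5-cycle, and exchanges \<open>B\<close> with \<open>C\<close>,
  so every fact about \<open>B\<close> has a dual about \<open>C\<close>.

  \<^emph>\<open>Structure.\<close> The vertices of \<open>C\<close> have so few neighbours that any proper coloring of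
  \<open>A \<union> B\<close> extends greedily to \<open>G\<close> without raising the number of colors above \<open>\<chi>(G) - 1\<close>. Hence
  \<open>\<chi>(G)\<close> is at most the number of colors in any proper coloring of \<open>A \<union> B\<close>, in particular at most
  \<open>b + 3\<close>, and dually the chromatic number of the complement is at most \<open>c + 3\<close>. For an NG-graph
  these numbers add up to \<open>n + 1 = b + c + 6\<close>, so both bounds are attained. If some vertex of \<open>B\<close>
  had a non-neighbour in \<open>A \<union> B\<close>, the two could share a color and \<open>b + 2\<close> colors would do
  (\<open>high_degree_part\<close>). So \<open>B\<close> is a clique completely joined to \<open>A\<close>; dually, \<open>C\<close> is independent
  and has no edges to \<open>A\<close>. Only the edges between \<open>B\<close> and \<open>C\<close> are left open.

  \<^emph>\<open>Coloring.\<close> An automorphism preserves degrees, hence the three parts. Give the vertices of \<open>B\<close>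
  different colors and use three further colors on the 5-cycle. An automorphism that preserves
  colors then fixes \<open>A \<union> B\<close> and can only permute vertices of \<open>C\<close> that have the same neighbourhood,
  so it is enough to give different colors to such twins. A twin class \<open>T \<subseteq> C\<close> with neighbourhood
  \<open>N \<subseteq> B\<close> may use every color that does not occur on \<open>N\<close>. It follows that
  \<open>\<chi>\<^sub>D(G) \<le> max (b + 3) (|T| + |N|)\<close>, the maximum being over all twin classes
  (\<open>distinguishing_chromatic_number_le\<close>).

  \<^emph>\<open>Counting.\<close> Exchanging two twins is an automorphism, so \<open>|T| \<le> D(G)\<close>, and \<open>D(G) \<ge> 2\<close> because
  the 5-cycle has a reflection. Let \<open>T \<subseteq> C\<close> and \<open>N \<subseteq> B\<close> be as above, and let \<open>S \<subseteq> B\<close> and \<open>M \<subseteq> C\<close> be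
  a twin class of the complement and its neighbourhood there. Between \<open>S\<close> and \<open>T\<close> either all edges
  are present or none: in the first case \<open>M\<close> and \<open>T\<close> are disjoint subsets of \<open>C\<close>, in the second \<open>N\<close>
  and \<open>S\<close> are disjoint subsets of \<open>B\<close>. Either way \<open>|T| + |N| + |S| + |M| \<le> b + c + D(G)\<close>. Together
  with the easier cases in which one of the maxima is \<open>b + 3\<close> or \<open>c + 3\<close>, the two distinguishing
  chromatic numbers add up to less than \<open>n + D(G)\<close>.
\<close>

abbreviation nbhd :: "'a pair_pre_digraph \<Rightarrow> 'a \<Rightarrow> 'a set" where
  "nbhd G v \<equiv> parcs G `` {v}"

lemma less_5_cases:
  assumes "i < (5::nat)"
  obtains "i = 0" | "i = 1" | "i = 2" | "i = 3" | "i = 4"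
  using assms by linarith

section \<open>Neighbourhoods, complements and automorphisms\<close>

lemma (in pair_graph) nbhd_subset: "nbhd G v \<subseteq> pverts G"
  by (auto dest: arcs_symmetric wellformed')

lemma (in pair_graph) finite_nbhd: "finite (nbhd G v)"
  using nbhd_subset finite_subset pair_finite_verts by blast

lemma out_degree_eq_card_nbhd: "out_degree (with_proj G) v = card (nbhd G v)"
proof -
  have "out_arcs (with_proj G) v = Pair v ` nbhd G v"
    by (auto simp: out_arcs_def)
  then show ?thesis
    unfolding out_degree_def by (simp add: card_image inj_on_def)
qed

lemma pverts_complement [simp]: "pverts (complement_graph G) = pverts G"
  by (simp add: complement_graph_def)

lemma parcs_complement_iff:
  "(u, v) \<in> parcs (complement_graph G) \<longleftrightarrow>
     u \<in> pverts G \<and> v \<in> pverts G \<and> u \<noteq> v \<and> (u, v) \<notin> parcs G"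
  by (simp add: complement_graph_def)

lemma card_nbhd_complement:
  assumes "pair_graph G" "v \<in> pverts G"
  shows "card (nbhd (complement_graph G) v) + card (nbhd G v) + 1 = card (pverts G)"
proof -
  interpret pair_graph G by fact
  have loop: "(v, v) \<notin> parcs G" using no_loops' by blast
  have eq: "pverts G = insert v (nbhd (complement_graph G) v \<union> nbhd G v)"
    using nbhd_subset assms(2) by (auto simp: parcs_complement_iff)
  have fin: "finite (nbhd (complement_graph G) v)"
    by (rule finite_subset[OF _ pair_finite_verts]) (auto simp: parcs_complement_iff)
  have "card (pverts G) = Suc (card (nbhd (complement_graph G) v \<union> nbhd G v))"
    using loop fin finite_nbhd by (subst eq, subst card_insert_disjoint)
      (auto simp: parcs_complement_iff)
  also have "card (nbhd (complement_graph G) v \<union> nbhd G v)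
      = card (nbhd (complement_graph G) v) + card (nbhd G v)"
    using fin finite_nbhd by (intro card_Un_disjoint) (auto simp: parcs_complement_iff)
  finally show ?thesis by simp
qed

lemma graph_automorphism_complement_iff:
  assumes "pair_graph G"
  shows "graph_automorphism (complement_graph G) f \<longleftrightarrow> graph_automorphism G f"
proof -
  have "((u, v) \<in> parcs (complement_graph G) \<longleftrightarrow> (f u, f v) \<in> parcs (complement_graph G))
      \<longleftrightarrow> ((u, v) \<in> parcs G \<longleftrightarrow> (f u, f v) \<in> parcs G)"
    if "bij_betw f (pverts G) (pverts G)" "u \<in> pverts G" "v \<in> pverts G" for u v
  proof -
    interpret pair_graph G by fact
    have "f u \<in> pverts G" "f v \<in> pverts G" "f u = f v \<longleftrightarrow> u = v"
      using that by (auto simp: bij_betw_def inj_on_eq_iff)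
    then show ?thesis
      using that no_loops' by (auto simp: parcs_complement_iff)
  qed
  then show ?thesis
    unfolding graph_automorphism_iff[OF assms]
      graph_automorphism_iff[OF pair_graph_complement_graph[OF assms]] pverts_complement
    by (intro conj_cong refl ball_cong) blast
qed

lemma distinguishing_number_complement:
  assumes "pair_graph G"
  shows "distinguishing_number (complement_graph G) = distinguishing_number G"
  by (simp add: distinguishing_number_def vertex_coloring_def distinguishing_coloring_def
      graph_automorphism_complement_iff[OF assms])

lemma automorphism_preserves_degree:
  assumes "pair_graph G" "graph_automorphism G f" "v \<in> pverts G"
  shows "card (nbhd G (f v)) = card (nbhd G v)"
proof -
  interpret pair_graph G by fact
  have f: "bij_betw f (pverts G) (pverts G)"
    and e: "\<And>u w. u \<in> pverts G \<Longrightarrow> w \<in> pverts G \<Longrightarrow> (u, w) \<in> parcs G \<longleftrightarrow> (f u, f w) \<in> parcs G"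
    using assms(2) graph_automorphism_iff[OF assms(1)] by auto
  have "nbhd G (f v) = f ` nbhd G v"
  proof
    show "f ` nbhd G v \<subseteq> nbhd G (f v)" using e nbhd_subset assms(3) by blast
    show "nbhd G (f v) \<subseteq> f ` nbhd G v"
    proof
      fix y assume y: "y \<in> nbhd G (f v)"
      then obtain u where "u \<in> pverts G" "y = f u"
        using nbhd_subset f by (metis bij_betw_imp_surj_on imageE subsetD)
      then show "y \<in> f ` nbhd G v" using y e assms(3) by auto
    qed
  qed
  moreover have "inj_on f (nbhd G v)"
    using f nbhd_subset by (meson bij_betw_imp_inj_on inj_on_subset)
  ultimately show ?thesis by (simp add: card_image)
qed

section \<open>Colorings\<close>

text \<open>
  Color the vertices outside \<open>S\<close> one at a time: when a vertex is reached, its fewer than \<open>m\<close>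
  neighbours block fewer than \<open>m\<close> colors.
\<close>

lemma (in pair_graph) greedy_extension:
  assumes "S \<subseteq> pverts G"
    and "\<And>v. v \<in> S \<Longrightarrow> c v < m"
    and "\<And>u v. u \<in> S \<Longrightarrow> v \<in> S \<Longrightarrow> (u, v) \<in> parcs G \<Longrightarrow> c u \<noteq> c v"
    and deg: "\<And>v. v \<in> pverts G - S \<Longrightarrow> card (nbhd G v) < m"
  obtains c' where "vertex_coloring G m c'" "proper_coloring G c'"
proof -
  have "\<exists>c'. (\<forall>v \<in> S \<union> T. c' v < m) \<and>
      (\<forall>u \<in> S \<union> T. \<forall>v \<in> S \<union> T. (u, v) \<in> parcs G \<longrightarrow> c' u \<noteq> c' v)"
    if "finite T" "T \<subseteq> pverts G - S" for T
    using that
  proof (induction T)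
    case empty
    then show ?case using assms(2,3) by (intro exI[of _ c]) auto
  next
    case (insert x T)
    then obtain c' where c': "\<forall>v \<in> S \<union> T. c' v < m"
      "\<forall>u \<in> S \<union> T. \<forall>v \<in> S \<union> T. (u, v) \<in> parcs G \<longrightarrow> c' u \<noteq> c' v"
      by auto
    have "card (c' ` nbhd G x) < card {..<m}"
      using deg[of x] insert.prems card_image_le[OF finite_nbhd, of c' x] by simp
    then have "\<not> {..<m} \<subseteq> c' ` nbhd G x"
      using card_mono[OF finite_imageI[OF finite_nbhd]] by (metis leD)
    then obtain k where k: "k < m" "k \<notin> c' ` nbhd G x" by auto
    have loop: "(x, x) \<notin> parcs G" using no_loops' by blast
    have "c' u \<noteq> k" if "(u, x) \<in> parcs G \<or> (x, u) \<in> parcs G" for u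
      using that k arcs_symmetric by blast
    then have "(\<forall>v \<in> S \<union> insert x T. (c'(x := k)) v < m) \<and>
      (\<forall>u \<in> S \<union> insert x T. \<forall>v \<in> S \<union> insert x T.
         (u, v) \<in> parcs G \<longrightarrow> (c'(x := k)) u \<noteq> (c'(x := k)) v)"
      using c' k loop by auto
    then show ?case by blast
  qed
  from this[of "pverts G - S"] obtain c' where
    "\<forall>v \<in> S \<union> (pverts G - S). c' v < m"
    "\<forall>u \<in> S \<union> (pverts G - S). \<forall>v \<in> S \<union> (pverts G - S). (u, v) \<in> parcs G \<longrightarrow> c' u \<noteq> c' v"
    using pair_finite_verts by auto
  moreover have "S \<union> (pverts G - S) = pverts G" using assms(1) by blast
  ultimately have "vertex_coloring G m c'" "proper_coloring G c'"
    using wellformed' by (fastforce simp: vertex_coloring_def proper_coloring_def)+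
  then show thesis by (rule that)
qed

lemma chromatic_number_le:
  assumes "vertex_coloring G k c" "proper_coloring G c"
  shows "chromatic_number G \<le> k"
  unfolding chromatic_number_def using assms by (blast intro: Least_le)

lemma (in pair_graph) chromatic_number_pos:
  assumes "pverts G \<noteq> {}"
  shows "0 < chromatic_number G"
proof -
  from ex_bij_betw_finite_nat[OF pair_finite_verts] obtain c
    where c: "bij_betw c (pverts G) {0..<card (pverts G)}" by blast
  have "c u \<noteq> c v" if "(u, v) \<in> parcs G" for u v
    using c that no_loops'[OF that] wellformed'[OF that] by (auto simp: bij_betw_def inj_on_eq_iff)
  then have "vertex_coloring G (card (pverts G)) c" "proper_coloring G c"
    using c by (auto simp: vertex_coloring_def proper_coloring_def bij_betw_def)
  then have "\<exists>c. vertex_coloring G (chromatic_number G) c \<and> proper_coloring G c"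
    unfolding chromatic_number_def
    by (rule_tac LeastI_ex) blast
  then show ?thesis using assms by (auto simp: vertex_coloring_def)
qed

lemma (in pair_graph) optimal_distinguishing_coloring:
  obtains c where "vertex_coloring G (distinguishing_number G) c" "distinguishing_coloring G c"
proof -
  from ex_bij_betw_finite_nat[OF pair_finite_verts] obtain c
    where c: "bij_betw c (pverts G) {0..<card (pverts G)}" by blast
  have "vertex_coloring G (card (pverts G)) c"
    using c by (auto simp: vertex_coloring_def bij_betw_def)
  moreover have "distinguishing_coloring G c"
    unfolding distinguishing_coloring_def graph_automorphism_iff[OF pair_graph_axioms]
    using c by (metis bij_betw_apply bij_betw_imp_inj_on inj_onD)
  ultimately have "\<exists>c. vertex_coloring G (distinguishing_number G) c \<and> distinguishing_coloring G c"
    unfolding distinguishing_number_def by (rule_tac LeastI_ex) blast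
  then show thesis using that by blast
qed

text \<open>
  Exchanging two vertices with the same neighbourhood is an automorphism, so a distinguishing
  coloring is injective on any set of such vertices.
\<close>

lemma (in pair_graph) card_twins_le_distinguishing_number:
  assumes "T \<subseteq> pverts G" and twin: "\<And>u v. u \<in> T \<Longrightarrow> v \<in> T \<Longrightarrow> nbhd G u = nbhd G v"
  shows "card T \<le> distinguishing_number G"
proof -
  obtain c where c: "vertex_coloring G (distinguishing_number G) c" "distinguishing_coloring G c"
    by (rule optimal_distinguishing_coloring)
  have "inj_on c T"
  proof (rule inj_onI, rule ccontr)
    fix u v assume uv: "u \<in> T" "v \<in> T" "c u = c v" "u \<noteq> v"
    let ?f = "transpose u v"
    have V: "u \<in> pverts G" "v \<in> pverts G" using uv assms(1) by auto
    have nb: "(u, w) \<in> parcs G \<longleftrightarrow> (v, w) \<in> parcs G" "(w, u) \<in> parcs G \<longleftrightarrow> (w, v) \<in> parcs G" for w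
      using twin[OF uv(1,2)] arcs_symmetric by blast+
    have "bij_betw ?f (pverts G) (pverts G)"
      using V by (auto simp: bij_betw_def inj_on_def transpose_def image_iff)
    moreover have "(?f x, y) \<in> parcs G \<longleftrightarrow> (x, y) \<in> parcs G"
      "(y, ?f x) \<in> parcs G \<longleftrightarrow> (y, x) \<in> parcs G" for x y
      unfolding transpose_def using nb[of y] by presburger+
    ultimately have "graph_automorphism G ?f"
      unfolding graph_automorphism_iff[OF pair_graph_axioms] by simp
    moreover have "\<forall>w \<in> pverts G. c (?f w) = c w" using uv by (simp add: transpose_def)
    ultimately have "?f u = u" using c(2) V unfolding distinguishing_coloring_def by blast
    then show False using uv by simp
  qed
  moreover have "c ` T \<subseteq> {..<distinguishing_number G}"
    using c(1) assms(1) by (auto simp: vertex_coloring_def)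
  ultimately show ?thesis by (metis card_inj_on_le card_lessThan finite_lessThan)
qed

section \<open>Induced 5-cycles\<close>

text \<open>
  The vertices are listed in cyclic order, so that the symmetries of the cycle act on the
  indices.
\<close>

definition induces_C5 :: "'a pair_pre_digraph \<Rightarrow> (nat \<Rightarrow> 'a) \<Rightarrow> bool" where
  "induces_C5 G p \<longleftrightarrow> inj_on p {..<5} \<and> p ` {..<5} \<subseteq> pverts G \<and>
     (\<forall>i<5. \<forall>j<5. (p i, p j) \<in> parcs G \<longleftrightarrow> j = (i + 1) mod 5 \<or> i = (j + 1) mod 5)"

lemma induces_C5_reindex:
  assumes "induces_C5 G p" "bij_betw q {..<5} {..<5}"
    and "\<And>i j. i < 5 \<Longrightarrow> j < 5 \<Longrightarrow>
      (q j = (q i + 1) mod 5 \<or> q i = (q j + 1) mod 5) \<longleftrightarrow> (j = (i + 1) mod 5 \<or> i = (j + 1) mod 5)"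
  shows "induces_C5 G (p \<circ> q)" "(p \<circ> q) ` {..<5} = p ` {..<5}"
proof -
  have q: "q ` {..<5} = {..<5}" "inj_on q {..<5}" using assms(2) by (auto simp: bij_betw_def)
  then show eq: "(p \<circ> q) ` {..<5} = p ` {..<5}" by (metis image_comp)
  have "q i < 5" if "i < 5" for i using q(1) that by auto
  then show "induces_C5 G (p \<circ> q)"
    using assms(1,3) q eq unfolding induces_C5_def by (simp add: comp_inj_on)
qed

lemma induces_C5_ending_at:
  assumes "induces_C5 G p" "y \<in> p ` {..<5}"
  obtains p' where "induces_C5 G p'" "p' ` {..<5} = p ` {..<5}" "p' 4 = y"
proof -
  obtain i where i: "i < 5" "y = p i" using assms(2) by auto
  define q where "q j = (j + i + 1) mod 5" for j :: nat
  have "q 4 = i" using i(1) by (simp add: q_def)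
  have s: "{..<5} = {0, 1, 2, 3, 4::nat}" by auto
  have b: "bij_betw q {..<5} {..<5}"
    using i(1) unfolding s by (cases rule: less_5_cases) (auto simp: q_def bij_betw_def)
  have "(q j' = (q j + 1) mod 5 \<or> q j = (q j' + 1) mod 5)
      \<longleftrightarrow> (j' = (j + 1) mod 5 \<or> j = (j' + 1) mod 5)" if "j < 5" "j' < 5" for j j'
    using i(1) that unfolding q_def by (elim less_5_cases) simp_all
  from induces_C5_reindex[OF assms(1) b this] show thesis
    using that[of "p \<circ> q"] \<open>q 4 = i\<close> i(2) by simp
qed

text \<open>
  The 5-cycle is self-complementary: doubling the indices modulo 5 exchanges the steps \<open>\<plusminus> 1\<close>
  with the steps \<open>\<plusminus> 2\<close>.
\<close>

lemma induces_C5_complement: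
  assumes "induces_C5 G p"
  shows "induces_C5 (complement_graph G) (\<lambda>i. p (2 * i mod 5))"
    and "(\<lambda>i. p (2 * i mod 5)) ` {..<5} = p ` {..<5}"
proof -
  have s: "{..<5} = {0, 1, 2, 3, 4::nat}" by auto
  show eq: "(\<lambda>i. p (2 * i mod 5)) ` {..<5} = p ` {..<5}"
    unfolding s by auto
  have inj: "inj_on p {..<5}" and V: "p ` {..<5} \<subseteq> pverts G"
    and e: "\<And>i j. i < 5 \<Longrightarrow> j < 5 \<Longrightarrow>
      (p i, p j) \<in> parcs G \<longleftrightarrow> j = (i + 1) mod 5 \<or> i = (j + 1) mod 5"
    using assms by (auto simp: induces_C5_def)
  have "inj_on (\<lambda>i. 2 * i mod 5 :: nat) {..<5}" unfolding s by (simp add: inj_on_def)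
  then have "inj_on (\<lambda>i. p (2 * i mod 5)) {..<5}"
    using inj comp_inj_on[of "\<lambda>i. 2 * i mod 5" "{..<5}" p]
      inj_on_subset[of p "{..<5}" "(\<lambda>i. 2 * i mod 5) ` {..<5}"]
    by (force simp: comp_def)
  moreover have "(p (2 * i mod 5), p (2 * j mod 5)) \<in> parcs (complement_graph G)
      \<longleftrightarrow> j = (i + 1) mod 5 \<or> i = (j + 1) mod 5" if "i < 5" "j < 5" for i j
  proof -
    have "(p (2 * i mod 5), p (2 * j mod 5)) \<in> parcs (complement_graph G)
      \<longleftrightarrow> 2 * i mod 5 \<noteq> 2 * j mod 5 \<and>
        \<not> (2 * j mod 5 = (2 * i mod 5 + 1) mod 5 \<or> 2 * i mod 5 = (2 * j mod 5 + 1) mod 5)"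
      using V inj e[of "2 * i mod 5" "2 * j mod 5"]
      by (auto simp: parcs_complement_iff inj_on_eq_iff)
    also have "\<dots> \<longleftrightarrow> j = (i + 1) mod 5 \<or> i = (j + 1) mod 5"
      using that by (elim less_5_cases) simp_all
    finally show ?thesis .
  qed
  ultimately show "induces_C5 (complement_graph G) (\<lambda>i. p (2 * i mod 5))"
    using V eq by (simp add: induces_C5_def)
qed

text \<open>
  The proper 3-coloring \<open>0, 1, 0, 1, 2\<close> serves two purposes. The color \<open>2\<close> occurs only once,
  so it can be given to another vertex not adjacent to \<open>p 4\<close>. No nontrivial symmetry of the cycle
  preserves the coloring: it would have to fix \<open>p 4\<close>, and the reflection in \<open>p 4\<close> exchanges the
  colors \<open>0\<close> and \<open>1\<close>.
\<close>

lemma induces_C5_coloring: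
  assumes "induces_C5 G p"
  obtains h :: "'a \<Rightarrow> nat" where "\<And>i. i < 5 \<Longrightarrow> h (p i) = [0, 1, 0, 1, 2] ! i"
    "\<And>x. x \<in> p ` {..<5} \<Longrightarrow> h x < 3"
    "\<And>x. x \<in> p ` {..<5} \<Longrightarrow> x \<noteq> p 4 \<Longrightarrow> h x < 2"
    "\<And>x y. x \<in> p ` {..<5} \<Longrightarrow> y \<in> p ` {..<5} \<Longrightarrow> (x, y) \<in> parcs G \<Longrightarrow> h x \<noteq> h y"
proof -
  have inj: "inj_on p {..<5}"
    and e: "\<And>i j. i < 5 \<Longrightarrow> j < 5 \<Longrightarrow>
      (p i, p j) \<in> parcs G \<longleftrightarrow> j = (i + 1) mod 5 \<or> i = (j + 1) mod 5"
    using assms by (auto simp: induces_C5_def)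
  define h :: "'a \<Rightarrow> nat" where "h x = [0, 1, 0, 1, 2] ! the_inv_into {..<5} p x" for x
  have h: "h (p i) = [0, 1, 0, 1, 2] ! i" if "i < 5" for i
    using that inj by (simp add: h_def the_inv_into_f_f)
  show thesis
  proof (rule that[of h])
    show "h (p i) = [0, 1, 0, 1, 2] ! i" if "i < 5" for i by (rule h[OF that])
    show "h x < 3" if "x \<in> p ` {..<5}" for x
    proof -
      from that obtain i where "i < 5" "x = p i" by auto
      then show ?thesis by (elim less_5_cases) (simp_all add: h)
    qed
    show "h x < 2" if "x \<in> p ` {..<5}" "x \<noteq> p 4" for x
    proof -
      from that obtain i where "i < 5" "x = p i" by auto
      with that(2) show ?thesis by (elim less_5_cases) (simp_all add: h)
    qed
    show "h x \<noteq> h y" if "x \<in> p ` {..<5}" "y \<in> p ` {..<5}" "(x, y) \<in> parcs G" for x y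
    proof -
      from that obtain i j where ij: "i < 5" "x = p i" "j < 5" "y = p j" by auto
      with that(3) have "j = (i + 1) mod 5 \<or> i = (j + 1) mod 5" by (simp add: e)
      with ij(1,3) show ?thesis unfolding ij(2,4) by (elim less_5_cases) (simp_all add: h)
    qed
  qed
qed

section \<open>Vertices of high degree and the chromatic number\<close>

text \<open>
  Vertices of degree below \<open>\<chi>(G) - 1\<close> do not contribute to the chromatic number: a coloring of the
  other vertices with at most \<open>\<chi>(G) - 1\<close> colors would extend greedily to all of \<open>G\<close>.
\<close>

lemma core_coloring_bound:
  assumes "pair_graph G" and ne: "pverts G \<noteq> {}" and "S \<subseteq> pverts G"
    and low: "\<And>v. v \<in> pverts G - S \<Longrightarrow> card (nbhd G v) < chromatic_number G - 1"
    and c: "\<And>v. v \<in> S \<Longrightarrow> c v < m"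
      "\<And>u v. u \<in> S \<Longrightarrow> v \<in> S \<Longrightarrow> (u, v) \<in> parcs G \<Longrightarrow> c u \<noteq> c v"
  shows "chromatic_number G \<le> m"
proof (rule ccontr)
  interpret pair_graph G by fact
  assume "\<not> chromatic_number G \<le> m"
  then have "c v < chromatic_number G - 1" if "v \<in> S" for v using c(1)[OF that] by simp
  then obtain c' where "vertex_coloring G (chromatic_number G - 1) c'" "proper_coloring G c'"
    using greedy_extension[of S c, OF assms(3) _ c(2) low] by blast
  then have "chromatic_number G \<le> chromatic_number G - 1" by (rule chromatic_number_le)
  then show False using chromatic_number_pos[OF ne] by simp
qed

text \<open>
  Both parts bound \<open>\<chi>(G)\<close> by a coloring of the 5-cycle and \<open>B\<close>: the first uses \<open>|B| + 3\<close> colors, the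
  second saves one by giving the same color to two non-adjacent vertices.
\<close>

lemma high_degree_part:
  fixes G :: "'a pair_pre_digraph"
  assumes "pair_graph G" and C5: "induces_C5 G p"
    and V: "pverts G = p ` {..<5} \<union> B \<union> C" and disj: "p ` {..<5} \<inter> B = {}"
    and low: "\<And>v. v \<in> C \<Longrightarrow> card (nbhd G v) < chromatic_number G - 1"
  shows "chromatic_number G \<le> card B + 3"
    and "\<lbrakk>chromatic_number G = card B + 3; x \<in> B; y \<in> p ` {..<5} \<union> B; x \<noteq> y\<rbrakk>
      \<Longrightarrow> (x, y) \<in> parcs G"
proof -
  interpret pair_graph G by fact
  let ?A = "p ` {..<5}"
  let ?S = "?A \<union> B"
  have ne: "pverts G \<noteq> {}" using V by (simp add: lessThan_empty_iff)
  have finB: "finite B" using V pair_finite_verts by simp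
  have low': "\<And>v. v \<in> pverts G - ?S \<Longrightarrow> card (nbhd G v) < chromatic_number G - 1"
    using V low by auto
  have bound: "chromatic_number G \<le> m"
    if "\<And>v. v \<in> ?S \<Longrightarrow> c v < m"
      "\<And>u v. u \<in> ?S \<Longrightarrow> v \<in> ?S \<Longrightarrow> (u, v) \<in> parcs G \<Longrightarrow> c u \<noteq> c v" for c m
    using core_coloring_bound[of G ?S c m, OF assms(1) ne _ low' that] V by blast
  show "chromatic_number G \<le> card B + 3"
  proof -
    obtain h :: "'a \<Rightarrow> nat" where h: "\<And>x. x \<in> ?A \<Longrightarrow> h x < 3"
      "\<And>x y. x \<in> ?A \<Longrightarrow> y \<in> ?A \<Longrightarrow> (x, y) \<in> parcs G \<Longrightarrow> h x \<noteq> h y"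
      by (rule induces_C5_coloring[OF C5]) blast
    obtain \<beta> where \<beta>: "bij_betw \<beta> B {0..<card B}"
      using ex_bij_betw_finite_nat[OF finB] by blast
    have \<beta>_lt: "\<beta> v < card B" if "v \<in> B" for v using \<beta> that by (auto simp: bij_betw_def)
    have \<beta>_inj: "\<beta> u = \<beta> v \<longleftrightarrow> u = v" if "u \<in> B" "v \<in> B" for u v
      using \<beta> that by (auto simp: bij_betw_def inj_on_eq_iff)
    show ?thesis
    proof (rule bound[of "\<lambda>v. if v \<in> B then \<beta> v else card B + h v"])
      fix v assume "v \<in> ?S"
      then show "(if v \<in> B then \<beta> v else card B + h v) < card B + 3"
        using h(1)[of v] \<beta>_lt[of v] by auto
    next
      fix u v assume "u \<in> ?S" "v \<in> ?S" "(u, v) \<in> parcs G"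
      then show "(if u \<in> B then \<beta> u else card B + h u) \<noteq> (if v \<in> B then \<beta> v else card B + h v)"
        using h(2)[of u v] \<beta>_lt[of u] \<beta>_lt[of v] \<beta>_inj[of u v] no_loops'[of u v] by auto
    qed
  qed
  show "(x, y) \<in> parcs G"
    if "chromatic_number G = card B + 3" "x \<in> B" "y \<in> ?A \<union> B" "x \<noteq> y"
  proof (rule ccontr)
    assume nadj: "(x, y) \<notin> parcs G"
    \<comment> \<open>If \<open>y\<close> lies on the cycle, turn the cycle so that \<open>y\<close> is its only vertex of color \<open>2\<close>.\<close>
    obtain p' where p': "induces_C5 G p'" "p' ` {..<5} = ?A" "y \<in> ?A \<Longrightarrow> p' 4 = y"
      using induces_C5_ending_at[OF C5] C5 by metis
    obtain h :: "'a \<Rightarrow> nat" where hp: "\<And>i. i < 5 \<Longrightarrow> h (p' i) = [0, 1, 0, 1, 2] ! i"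
      and h: "\<And>x. x \<in> ?A \<Longrightarrow> h x < 3" "\<And>x. x \<in> ?A \<Longrightarrow> x \<noteq> p' 4 \<Longrightarrow> h x < 2"
      "\<And>x y. x \<in> ?A \<Longrightarrow> y \<in> ?A \<Longrightarrow> (x, y) \<in> parcs G \<Longrightarrow> h x \<noteq> h y"
      by (rule induces_C5_coloring[OF p'(1), unfolded p'(2)]) blast
    have h4: "h (p' 4) = 2" using hp[of 4] by simp
    define b where "b = card (B - {x})"
    have b: "card B = b + 1" unfolding b_def using that(2) finB
      by (metis Suc_eq_plus1 card_Suc_Diff1)
    obtain \<beta> where \<beta>: "bij_betw \<beta> (B - {x}) {0..<b}"
      using ex_bij_betw_finite_nat[of "B - {x}"] finB b_def by blast
    have \<beta>_lt: "\<beta> v < b" if "v \<in> B" "v \<noteq> x" for v using \<beta> that by (auto simp: bij_betw_def)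
    have \<beta>_inj: "\<beta> u = \<beta> v \<longleftrightarrow> u = v" if "u \<in> B" "v \<in> B" "u \<noteq> x" "v \<noteq> x" for u v
      using \<beta> that by (auto simp: bij_betw_def inj_on_eq_iff)
    define c0 where "c0 v = (if v \<in> B then \<beta> v else b + h v)" for v
    define c where "c = c0(x := c0 y)"
    have c0_lt: "c0 v < b + 3" if "v \<in> ?S" "v \<noteq> x" for v
      using that h(1)[of v] \<beta>_lt[of v] by (auto simp: c0_def)
    have c0_proper: "c0 u \<noteq> c0 v"
      if "u \<in> ?S" "v \<in> ?S" "u \<noteq> x" "v \<noteq> x" "(u, v) \<in> parcs G" for u v
      using that h(3)[of u v] \<beta>_lt[of u] \<beta>_lt[of v] \<beta>_inj[of u v] no_loops'[of u v]
      by (auto simp: c0_def)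
    have c0_y: "c0 v \<noteq> c0 y" if v: "v \<in> ?S" "v \<noteq> x" "v \<noteq> y" for v
    proof (cases "y \<in> B")
      case True
      then show ?thesis
        using v \<open>x \<noteq> y\<close> \<beta>_lt[of y] \<beta>_inj[of v y] by (auto simp: c0_def)
    next
      case False
      then have "y \<in> ?A" using that(3) \<open>y \<in> ?A \<union> B\<close> by auto
      with p'(3) have "p' 4 = y" by simp
      then show ?thesis
        using v False h4 h(2)[of v] \<beta>_lt[of v] by (auto simp: c0_def)
    qed
    have "chromatic_number G \<le> b + 3"
    proof (rule bound[of c])
      fix v assume "v \<in> ?S"
      then show "c v < b + 3" using c0_lt[of v] c0_lt[of y] that(3,4) by (auto simp: c_def)
    next
      fix u v assume uv: "u \<in> ?S" "v \<in> ?S" "(u, v) \<in> parcs G"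
      then have "u \<noteq> v" "(v, u) \<in> parcs G" using no_loops' arcs_symmetric by blast+
      then show "c u \<noteq> c v"
        using uv c0_proper[of u v] c0_y[of u] c0_y[of v] nadj
        by (cases "u = x"; cases "v = x"; cases "u = y"; cases "v = y") (simp_all add: c_def)
    qed
    then show False using that(1) b by simp
  qed
qed

section \<open>Distinguishing colorings of the split structure\<close>

text \<open>
  The structure of Type 3 NG-graphs: a split graph with clique \<open>B\<close> and independent set \<open>C\<close>, and a
  5-cycle joined to all of \<open>B\<close> and to nothing in \<open>C\<close>.
\<close>

locale C5_split = pair_graph G for G :: "'a pair_pre_digraph" +
  fixes B C :: "'a set" and p :: "nat \<Rightarrow> 'a"
  assumes C5: "induces_C5 G p"
    and verts: "pverts G = p ` {..<5} \<union> B \<union> C"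
    and disjoint: "p ` {..<5} \<inter> B = {}" "p ` {..<5} \<inter> C = {}" "B \<inter> C = {}"
    and join: "\<And>x y. x \<in> B \<Longrightarrow> y \<in> p ` {..<5} \<union> B \<Longrightarrow> x \<noteq> y \<Longrightarrow> (x, y) \<in> parcs G"
    and no_arcs: "\<And>x y. x \<in> C \<Longrightarrow> y \<in> p ` {..<5} \<union> C \<Longrightarrow> (x, y) \<notin> parcs G"
begin

abbreviation A :: "'a set" where "A \<equiv> p ` {..<5}"

text \<open>This duality lets every result about \<open>G\<close> be used for the complement as well.\<close>

lemma complement_split: "C5_split (complement_graph G) C B (\<lambda>i. p (2 * i mod 5))"
proof -
  have join': "(x, y) \<in> parcs (complement_graph G)" if "x \<in> C" "y \<in> A \<union> C" "x \<noteq> y" for x y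
    using that verts no_arcs by (auto simp: parcs_complement_iff)
  have no_arcs': "(x, y) \<notin> parcs (complement_graph G)" if "x \<in> B" "y \<in> A \<union> B" for x y
    using that join by (auto simp: parcs_complement_iff)
  show ?thesis
    unfolding C5_split_def C5_split_axioms_def induces_C5_complement(2)[OF C5]
    using pair_graph_complement_graph[OF pair_graph_axioms] induces_C5_complement(1)[OF C5]
      verts disjoint join' no_arcs' by auto
qed

lemma finite_parts: "finite B" "finite C"
  using verts pair_finite_verts by auto

lemma inj_p: "inj_on p {..<5}"
  using C5 by (simp add: induces_C5_def)

lemma arc_p: "i < 5 \<Longrightarrow> j < 5 \<Longrightarrow>
    (p i, p j) \<in> parcs G \<longleftrightarrow> j = (i + 1) mod 5 \<or> i = (j + 1) mod 5"
  using C5 by (simp add: induces_C5_def)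

lemma card_verts: "card (pverts G) = 5 + card B + card C"
proof -
  have "card A = 5" using inj_p by (simp add: card_image)
  moreover have "card (A \<union> B) = card A + card B"
    using disjoint finite_parts by (intro card_Un_disjoint) auto
  moreover have "card (A \<union> B \<union> C) = card (A \<union> B) + card C"
    using disjoint finite_parts by (intro card_Un_disjoint) auto
  ultimately show ?thesis by (simp add: verts)
qed

lemma arcs_B_A: "x \<in> B \<Longrightarrow> y \<in> A \<Longrightarrow> (x, y) \<in> parcs G"
  using join[of x y] disjoint(1) by blast

lemma arcs_A_B: "x \<in> A \<Longrightarrow> y \<in> B \<Longrightarrow> (x, y) \<in> parcs G"
  using arcs_B_A arcs_symmetric by blast

lemma no_arcs_A_C: "x \<in> A \<Longrightarrow> y \<in> C \<Longrightarrow> (x, y) \<notin> parcs G"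
  using no_arcs arcs_symmetric by blast

lemma nbhd_C: "v \<in> C \<Longrightarrow> nbhd G v \<subseteq> B"
  using nbhd_subset[of v] verts no_arcs[of v] by auto

lemma degree_A:
  assumes "v \<in> A"
  shows "card (nbhd G v) = card B + 2"
proof -
  obtain i where i: "i < 5" "v = p i" using assms by auto
  have "nbhd G v = p ` {j. j < 5 \<and> (j = (i + 1) mod 5 \<or> i = (j + 1) mod 5)} \<union> B" (is "_ = p ` ?J \<union> B")
  proof (intro set_eqI iffI)
    fix y assume y: "y \<in> nbhd G v"
    then have "y \<in> A \<union> B \<union> C" using nbhd_subset verts by blast
    then consider j where "j < 5" "y = p j" | "y \<in> B" | "y \<in> C" by blast
    then show "y \<in> p ` ?J \<union> B"
      using y i arc_p no_arcs_A_C[OF assms] by cases auto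
  next
    fix y assume "y \<in> p ` ?J \<union> B"
    then consider j where "j \<in> ?J" "y = p j" | "y \<in> B" by blast
    then show "y \<in> nbhd G v"
      using i arc_p arcs_A_B[OF assms] by cases auto
  qed
  moreover have "card ?J = 2"
  proof -
    have "?J = {(i + 1) mod 5, (i + 4) mod 5}"
    proof (intro set_eqI)
      fix j
      show "j \<in> ?J \<longleftrightarrow> j \<in> {(i + 1) mod 5, (i + 4) mod 5}"
      proof (cases "j < 5")
        case True
        with i(1) show ?thesis by (elim less_5_cases) simp_all
      qed (use i(1) in auto)
    qed
    then show ?thesis using i(1) by (elim less_5_cases) simp_all
  qed
  moreover have "card (p ` ?J) = card ?J"
    by (rule card_image) (rule inj_on_subset[OF inj_p], auto)
  moreover have "card (p ` ?J \<union> B) = card (p ` ?J) + card B"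
    using finite_parts disjoint(1) by (intro card_Un_disjoint) auto
  ultimately show ?thesis by simp
qed

lemma degree_B:
  assumes "v \<in> B"
  shows "card B + 2 < card (nbhd G v)"
proof -
  have "A \<union> (B - {v}) \<subseteq> nbhd G v" using join[OF assms] disjoint(1) assms by auto
  then have "card (A \<union> (B - {v})) \<le> card (nbhd G v)" by (rule card_mono[OF finite_nbhd])
  moreover have "card (A \<union> (B - {v})) = card A + card (B - {v})"
    using finite_parts disjoint(1) by (intro card_Un_disjoint) auto
  moreover have "card A = 5" using inj_p by (simp add: card_image)
  moreover have "card B = Suc (card (B - {v}))"
    using assms finite_parts by (metis card_Suc_Diff1)
  ultimately show ?thesis by simp
qed

lemma degree_C: "v \<in> C \<Longrightarrow> card (nbhd G v) < card B + 2"
  using card_mono[OF finite_parts(1) nbhd_C] by fastforce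

text \<open>The degrees in the three parts are equal to, above and below \<open>|B| + 2\<close>.\<close>

lemma automorphism_preserves_parts:
  assumes "graph_automorphism G f"
  shows "v \<in> A \<Longrightarrow> f v \<in> A" "v \<in> B \<Longrightarrow> f v \<in> B" "v \<in> C \<Longrightarrow> f v \<in> C"
proof -
  have "f v \<in> A \<union> B \<union> C" "card (nbhd G (f v)) = card (nbhd G v)" if "v \<in> A \<union> B \<union> C"
    using that assms automorphism_preserves_degree[OF pair_graph_axioms assms]
    by (auto simp: graph_automorphism_iff[OF pair_graph_axioms] verts bij_betw_def)
  then show "v \<in> A \<Longrightarrow> f v \<in> A" "v \<in> B \<Longrightarrow> f v \<in> B" "v \<in> C \<Longrightarrow> f v \<in> C"
    using degree_A degree_B degree_C
    by (metis UnCI UnE less_irrefl less_asym)+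
qed

text \<open>
  A reflection of the 5-cycle, extended by the identity, is a nontrivial automorphism, because
  vertices outside the cycle are adjacent to all of it or to none of it.
\<close>

lemma two_le_distinguishing_number: "2 \<le> distinguishing_number G"
proof (rule ccontr)
  assume "\<not> 2 \<le> distinguishing_number G"
  obtain c where c: "vertex_coloring G (distinguishing_number G) c" "distinguishing_coloring G c"
    by (rule optimal_distinguishing_coloring)
  have const: "c u = c v" if "u \<in> pverts G" "v \<in> pverts G" for u v
  proof -
    have "c u < distinguishing_number G" "c v < distinguishing_number G"
      using c(1) that by (auto simp: vertex_coloring_def)
    then show ?thesis using \<open>\<not> 2 \<le> distinguishing_number G\<close> by linarith
  qed
  have p_verts: "p i \<in> pverts G" if "i < 5" for i using that verts by auto
  have p_eq: "p i = p j \<longleftrightarrow> i = j" if "i < 5" "j < 5" for i j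
    using inj_p that by (simp add: inj_on_eq_iff)
  \<comment> \<open>The reflection that fixes \<open>p 0\<close>.\<close>
  define f where "f = transpose (p 1) (p 4) \<circ> transpose (p 2) (p 3)"
  define r where "r i = (5 - i) mod 5" for i :: nat
  have r: "r i < 5" for i by (simp add: r_def)
  have fp: "f (p i) = p (r i)" if "i < 5" for i
    using that by (elim less_5_cases) (simp_all add: f_def r_def transpose_def p_eq)
  have fout: "f v = v" if "v \<notin> A" for v
  proof -
    have "v \<noteq> p i" if "i < 5" for i using \<open>v \<notin> A\<close> that by auto
    then show ?thesis by (simp add: f_def transpose_def)
  qed
  have perm: "transpose x y permutes pverts G" if "x \<in> pverts G" "y \<in> pverts G" for x y
    using that by (rule permutes_swap_id)
  have "f permutes pverts G"
    unfolding f_def by (intro permutes_compose perm p_verts) simp_all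
  then have "bij_betw f (pverts G) (pverts G)" by (rule permutes_imp_bij)
  moreover have "(u, v) \<in> parcs G \<longleftrightarrow> (f u, f v) \<in> parcs G"
    if "u \<in> pverts G" "v \<in> pverts G" for u v
  proof -
    have fA: "f w \<in> A" if "w \<in> A" for w using that fp r by auto
    consider "u \<in> A" "v \<in> A" | "u \<in> A" "v \<in> B" | "u \<in> A" "v \<in> C" | "u \<in> B" "v \<in> A"
      | "u \<in> C" "v \<in> A" | "u \<notin> A" "v \<notin> A" using \<open>u \<in> pverts G\<close> \<open>v \<in> pverts G\<close> verts by blast
    then show ?thesis
    proof cases
      case 1
      then obtain i j where ij: "i < 5" "u = p i" "j < 5" "v = p j" by auto
      have "r j = (r i + 1) mod 5 \<or> r i = (r j + 1) mod 5
          \<longleftrightarrow> j = (i + 1) mod 5 \<or> i = (j + 1) mod 5"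
        using ij(1,3) unfolding r_def by (elim less_5_cases) simp_all
      then show ?thesis using ij r by (simp add: fp arc_p)
    next
      case 2
      then have "f v = v" "f u \<in> A" using fout[of v] fA disjoint(1) by blast+
      with \<open>u \<in> A\<close> \<open>v \<in> B\<close> show ?thesis by (simp add: arcs_A_B)
    next
      case 3
      then have "f v = v" "f u \<in> A" using fout[of v] fA disjoint(2) by blast+
      with \<open>u \<in> A\<close> \<open>v \<in> C\<close> show ?thesis by (simp add: no_arcs_A_C)
    next
      case 4
      then have "f u = u" "f v \<in> A" using fout[of u] fA disjoint(1) by blast+
      with \<open>v \<in> A\<close> \<open>u \<in> B\<close> show ?thesis by (simp add: arcs_B_A)
    next
      case 5
      then have "f u = u" "f v \<in> A" using fout[of u] fA disjoint(2) by blast+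
      with \<open>v \<in> A\<close> \<open>u \<in> C\<close> show ?thesis by (simp add: no_arcs)
    next
      case 6
      then show ?thesis by (simp add: fout)
    qed
  qed
  ultimately have "graph_automorphism G f"
    unfolding graph_automorphism_iff[OF pair_graph_axioms] by blast
  moreover have "\<forall>v \<in> pverts G. c (f v) = c v"
    using const \<open>f permutes pverts G\<close> by (metis permutes_in_image)
  ultimately have "f (p 1) = p 1"
    using c(2) p_verts[of 1] unfolding distinguishing_coloring_def by simp
  then show False using p_eq[of 4 1] fp[of 1] by (simp add: r_def)
qed

definition twins :: "'a \<Rightarrow> 'a set" where
  "twins v = {w \<in> C. nbhd G w = nbhd G v}"

lemma card_twins_le: "card (twins v) \<le> distinguishing_number G"
  by (rule card_twins_le_distinguishing_number) (auto simp: twins_def verts)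

text \<open>
  Colors below \<open>|B|\<close> are given injectively to \<open>B\<close>, the next three to the 5-cycle, and each twin class
  in \<open>C\<close> is colored injectively with colors that do not occur on its neighbourhood; the hypothesis
  says that there is room for this. Colors may be repeated between different twin classes and
  between \<open>C\<close> and the cycle. A color-preserving automorphism keeps the parts, so it fixes \<open>B\<close>
  pointwise and the cycle by the choice of its coloring; therefore it maps each vertex of \<open>C\<close> to a
  twin of the same color, which is the vertex itself.
\<close>

lemma distinguishing_chromatic_number_le:
  assumes K: "card B + 3 \<le> K"
    and room: "\<And>v. v \<in> C \<Longrightarrow> card (twins v) + card (nbhd G v) \<le> K"
  shows "distinguishing_chromatic_number G \<le> K"
proof -
  obtain h :: "'a \<Rightarrow> nat" where hp: "\<And>i. i < 5 \<Longrightarrow> h (p i) = [0, 1, 0, 1, 2] ! i"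
    and h: "\<And>x. x \<in> A \<Longrightarrow> h x < 3"
      "\<And>x y. x \<in> A \<Longrightarrow> y \<in> A \<Longrightarrow> (x, y) \<in> parcs G \<Longrightarrow> h x \<noteq> h y"
    by (rule induces_C5_coloring[OF C5]) blast
  obtain \<beta> where \<beta>: "bij_betw \<beta> B {0..<card B}"
    using ex_bij_betw_finite_nat[OF finite_parts(1)] by blast
  have \<beta>_lt: "\<beta> v < card B" if "v \<in> B" for v using \<beta> that by (auto simp: bij_betw_def)
  have \<beta>_inj: "\<beta> u = \<beta> v \<longleftrightarrow> u = v" if "u \<in> B" "v \<in> B" for u v
    using \<beta> that by (auto simp: bij_betw_def inj_on_eq_iff)
  have ex: "\<exists>g. g ` {w \<in> C. nbhd G w = N} \<subseteq> {..<K} - \<beta> ` N \<and> inj_on g {w \<in> C. nbhd G w = N}" for N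
  proof (cases "\<exists>v \<in> C. nbhd G v = N")
    case True
    then obtain v where v: "v \<in> C" "nbhd G v = N" by blast
    then have N: "N \<subseteq> B" using nbhd_C by blast
    then have "\<beta> ` N \<subseteq> {..<K}" using \<beta>_lt K by fastforce
    moreover have "card (\<beta> ` N) = card N"
      using \<beta> N by (meson bij_betw_imp_inj_on card_image inj_on_subset)
    ultimately have "card ({..<K} - \<beta> ` N) = K - card N"
      by (metis card_Diff_subset card_lessThan finite_lessThan finite_subset)
    moreover have "card {w \<in> C. nbhd G w = N} + card N \<le> K"
      using room[OF v(1)] v(2) by (simp add: twins_def)
    ultimately have "card {w \<in> C. nbhd G w = N} \<le> card ({..<K} - \<beta> ` N)" by simp
    then show ?thesis using finite_parts by (intro card_le_inj) simp_all
  next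
    case False
    then have "{w \<in> C. nbhd G w = N} = {}" by blast
    then show ?thesis by (simp only: image_empty empty_subsetI inj_on_empty) simp
  qed
  \<comment> \<open>The color of a vertex of \<open>C\<close> is chosen uniformly for its twin class, indexed by the neighbourhood.\<close>
  from choice[OF allI[OF ex]] obtain \<gamma> where
    "\<forall>N. \<gamma> N ` {w \<in> C. nbhd G w = N} \<subseteq> {..<K} - \<beta> ` N
      \<and> inj_on (\<gamma> N) {w \<in> C. nbhd G w = N}"
    by (rule exE)
  then have \<gamma>: "\<gamma> N ` {w \<in> C. nbhd G w = N} \<subseteq> {..<K} - \<beta> ` N"
    "inj_on (\<gamma> N) {w \<in> C. nbhd G w = N}" for N
    by (simp_all only:)
  define c where "c v = (if v \<in> B then \<beta> v else if v \<in> A then card B + h v else \<gamma> (nbhd G v) v)" for v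
  have cA: "c v = card B + h v" if "v \<in> A" for v using that disjoint(1) by (auto simp: c_def)
  have cB: "c v = \<beta> v" if "v \<in> B" for v using that by (simp add: c_def)
  have cC: "c v = \<gamma> (nbhd G v) v" if "v \<in> C" for v using that disjoint by (auto simp: c_def)
  have cC_in: "c v \<in> {..<K} - \<beta> ` nbhd G v" if "v \<in> C" for v
    using that \<gamma>(1)[of "nbhd G v"] cC by auto
  have "vertex_coloring G K c"
    unfolding vertex_coloring_def
  proof
    fix v assume "v \<in> pverts G"
    then consider "v \<in> A" | "v \<in> B" | "v \<in> C" using verts by blast
    then show "c v < K"
    proof cases
      case 1
      then show ?thesis using h(1)[OF 1] K by (simp add: cA)
    next
      case 2
      then show ?thesis using \<beta>_lt[OF 2] K by (simp add: cB)
    next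
      case 3
      then show ?thesis using cC_in[OF 3] by simp
    qed
  qed
  moreover have "proper_coloring G c"
  proof -
    have BC: "c u \<noteq> c v" if "u \<in> B" "v \<in> C" "(v, u) \<in> parcs G" for u v
    proof -
      have "\<beta> u \<in> \<beta> ` nbhd G v" using that(3) by (intro imageI) simp
      then show ?thesis using cC_in[OF that(2)] cB[OF that(1)] by auto
    qed
    have AB: "c u \<noteq> c v" if "u \<in> A" "v \<in> B" for u v
      using that \<beta>_lt[of v] by (simp add: cA cB)
    have "c u \<noteq> c v" if uv: "(u, v) \<in> parcs G" for u v
    proof -
      have "u \<in> A \<union> B \<union> C" "v \<in> A \<union> B \<union> C" "u \<noteq> v" "(v, u) \<in> parcs G"
        using wellformed'[OF uv] no_loops'[OF uv] uv verts arcs_symmetric by blast+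
      then consider "u \<in> A" "v \<in> A" | "u \<in> A" "v \<in> B" | "u \<in> B" "v \<in> A" | "u \<in> B" "v \<in> B"
        | "u \<in> B" "v \<in> C" | "u \<in> C" "v \<in> B"
        using no_arcs no_arcs_A_C uv by blast
      then show ?thesis
      proof cases
        case 1
        then show ?thesis using h(2) uv by (simp add: cA)
      next
        case 2
        then show ?thesis using AB by blast
      next
        case 3
        then show ?thesis using AB[of v u] by simp
      next
        case 4
        then show ?thesis using \<beta>_inj \<open>u \<noteq> v\<close> by (simp add: cB)
      next
        case 5
        then show ?thesis using BC \<open>(v, u) \<in> parcs G\<close> by blast
      next
        case 6
        then show ?thesis using BC[of v u] uv by simp
      qed
    qed
    then show ?thesis by (auto simp: proper_coloring_def)
  qed
  moreover have "distinguishing_coloring G c"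
    unfolding distinguishing_coloring_def
  proof (intro allI impI ballI)
    fix f v
    assume f: "graph_automorphism G f" and cf: "\<forall>v \<in> pverts G. c (f v) = c v" and v: "v \<in> pverts G"
    note parts = automorphism_preserves_parts[OF f]
    have arc_f: "(f u, f w) \<in> parcs G \<longleftrightarrow> (u, w) \<in> parcs G"
      if "u \<in> pverts G" "w \<in> pverts G" for u w
      using f that by (simp add: graph_automorphism_iff[OF pair_graph_axioms])
    have fB: "f u = u" if "u \<in> B" for u
    proof -
      have "c (f u) = c u" using cf that verts by blast
      then show ?thesis using parts(2)[OF that] that by (simp add: cB \<beta>_inj)
    qed
    have fp: "\<exists>j<5. f (p i) = p j \<and> h (p j) = h (p i)" if "i < 5" for i
    proof -
      have A: "p i \<in> A" using that by simp
      then have "f (p i) \<in> A" by (rule parts(1))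
      moreover have "c (f (p i)) = c (p i)" using cf A verts by blast
      ultimately show ?thesis using A by (auto simp: cA)
    qed
    have f4: "f (p 4) = p 4"
    proof -
      obtain j where "j < 5" "f (p 4) = p j" "h (p j) = h (p 4)" using fp[of 4] by auto
      then show ?thesis by (elim less_5_cases) (simp_all add: hp)
    qed
    \<comment> \<open>Of two cycle vertices with the same color, exactly one is adjacent to \<open>p 4\<close>.\<close>
    have fA: "f (p i) = p i" if i: "i < 5" for i
    proof -
      obtain j where j: "j < 5" "f (p i) = p j" "h (p j) = h (p i)" using fp[OF i] by auto
      have "(p j, p 4) \<in> parcs G \<longleftrightarrow> (p i, p 4) \<in> parcs G"
        using arc_f[of "p i" "p 4"] j(2) f4 i verts by simp
      then have "(4 = (j + 1) mod 5 \<or> j = 0) \<longleftrightarrow> (4 = (i + 1) mod 5 \<or> i = 0)"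
        using j(1) i by (simp add: arc_p)
      then have "j = i"
        using j(1) j(3) i by (elim less_5_cases) (simp_all add: hp)
      then show ?thesis using j(2) by simp
    qed
    consider i where "i < 5" "v = p i" | "v \<in> B" | "v \<in> C" using v verts by blast
    then show "f v = v"
    proof cases
      case 3
      then have C: "f v \<in> C" by (rule parts(3))
      have "(f v, u) \<in> parcs G \<longleftrightarrow> (v, u) \<in> parcs G" if "u \<in> B" for u
        using arc_f[of v u] fB[OF that] v that verts by auto
      then have "nbhd G (f v) = nbhd G v" using nbhd_C[OF C] nbhd_C[OF 3] by blast
      moreover have "c (f v) = c v" using cf v by blast
      ultimately have "\<gamma> (nbhd G v) (f v) = \<gamma> (nbhd G v) v" using 3 C by (simp add: cC)
      with \<gamma>(2)[of "nbhd G v"] show ?thesis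
        by (rule inj_onD) (use 3 C \<open>nbhd G (f v) = nbhd G v\<close> in blast)+
    qed (simp_all add: fA fB)
  qed
  ultimately show ?thesis
    unfolding distinguishing_chromatic_number_def by (blast intro: Least_le)
qed

text \<open>
  The bound by a maximum, in the form of a case distinction on where it is attained.
\<close>

lemma distinguishing_chromatic_number_cases:
  obtains "distinguishing_chromatic_number G \<le> card B + 3"
  | v where "v \<in> C" "distinguishing_chromatic_number G \<le> card (twins v) + card (nbhd G v)"
proof (cases "distinguishing_chromatic_number G \<le> card B + 3")
  case False
  then have "\<not> distinguishing_chromatic_number G \<le> distinguishing_chromatic_number G - 1"
    and "card B + 3 \<le> distinguishing_chromatic_number G - 1" by simp_all
  then obtain v where "v \<in> C"
    "\<not> card (twins v) + card (nbhd G v) \<le> distinguishing_chromatic_number G - 1"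
    using distinguishing_chromatic_number_le by blast
  then show thesis using that(2) by simp
qed (rule that(1))

end

section \<open>The defect in the Nordhaus-Gaddum count\<close>

text \<open>
  Each distinguishing chromatic number is bounded either by the 5-cycle or by a twin class. When
  both come from twin classes, at most one of the two class sizes counts in addition to
  \<open>|B| + |C|\<close>, because the other class is disjoint from a neighbourhood in its own part.
\<close>

lemma (in C5_split) not_NGD_graph: "\<not> NGD_graph G"
proof -
  interpret co: C5_split "complement_graph G" C B "\<lambda>i. p (2 * i mod 5)"
    by (rule complement_split)
  let ?D = "distinguishing_number G"
  have D: "2 \<le> ?D" by (rule two_le_distinguishing_number)
  have co_D: "distinguishing_number (complement_graph G) = ?D"
    by (rule distinguishing_number_complement[OF pair_graph_axioms])
  have T_le: "card (twins v) \<le> ?D" for v by (rule card_twins_le)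
  have S_le: "card (co.twins w) \<le> ?D" for w using co.card_twins_le[of w] co_D by simp
  have N_le: "card (nbhd G v) \<le> card B" if "v \<in> C" for v
    using card_mono[OF finite_parts(1) nbhd_C[OF that]] .
  have M_le: "card (nbhd (complement_graph G) w) \<le> card C" if "w \<in> B" for w
    using card_mono[OF finite_parts(2) co.nbhd_C[OF that]] .
  have both: "card (twins v) + card (nbhd G v)
      + (card (co.twins w) + card (nbhd (complement_graph G) w)) \<le> card B + card C + ?D"
    if v: "v \<in> C" and w: "w \<in> B" for v w
  proof (cases "(v, w) \<in> parcs G")
    case True
    have "card (twins v \<union> nbhd (complement_graph G) w) \<le> card C"
      using co.nbhd_C[OF w] finite_parts by (intro card_mono) (auto simp: twins_def)
    moreover have "twins v \<inter> nbhd (complement_graph G) w = {}"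
    proof -
      have "(u, w) \<in> parcs G" if "u \<in> twins v" for u using that True by (auto simp: twins_def)
      then show ?thesis using arcs_symmetric by (auto simp: parcs_complement_iff)
    qed
    then have "card (twins v \<union> nbhd (complement_graph G) w)
        = card (twins v) + card (nbhd (complement_graph G) w)"
      using finite_parts co.finite_nbhd by (intro card_Un_disjoint) (auto simp: twins_def)
    ultimately show ?thesis using N_le[OF v] S_le[of w] by linarith
  next
    case False
    have "card (nbhd G v \<union> co.twins w) \<le> card B"
      using nbhd_C[OF v] finite_parts by (intro card_mono) (auto simp: co.twins_def)
    moreover have "nbhd G v \<inter> co.twins w = {}"
    proof -
      have "(w, v) \<in> parcs (complement_graph G)"
        using False v w verts disjoint(3) arcs_symmetric by (auto simp: parcs_complement_iff)
      then have "(u, v) \<in> parcs (complement_graph G)" if "u \<in> co.twins w" for u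
        using that by (auto simp: co.twins_def)
      then show ?thesis using arcs_symmetric by (auto simp: parcs_complement_iff)
    qed
    then have "card (nbhd G v \<union> co.twins w) = card (nbhd G v) + card (co.twins w)"
      using finite_parts finite_nbhd by (intro card_Un_disjoint) (auto simp: co.twins_def)
    ultimately show ?thesis using M_le[OF w] T_le[of v] by linarith
  qed
  have "distinguishing_chromatic_number G + distinguishing_chromatic_number (complement_graph G)
      < card (pverts G) + ?D"
  proof (cases rule: distinguishing_chromatic_number_cases)
    case 1
    then show ?thesis
    proof (cases rule: co.distinguishing_chromatic_number_cases)
      case 1
      with \<open>distinguishing_chromatic_number G \<le> card B + 3\<close> show ?thesis
        using D card_verts by linarith
    next
      case (2 w)
      with \<open>distinguishing_chromatic_number G \<le> card B + 3\<close> show ?thesis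
        using S_le[of w] M_le[of w] card_verts by linarith
    qed
  next
    case (2 v)
    note v = 2
    show ?thesis
    proof (cases rule: co.distinguishing_chromatic_number_cases)
      case 1
      with v show ?thesis using T_le[of v] N_le[of v] card_verts by linarith
    next
      case (2 w)
      with v show ?thesis using both[of v w] card_verts by linarith
    qed
  qed
  then show ?thesis by (simp add: NGD_graph_def)
qed

section \<open>From Type 3 to the split structure\<close>

lemma type_3_induces_C5:
  assumes "pair_graph G" "type_3 G"
  obtains p where "induces_C5 G p" "p ` {..<5} = A_set G"
proof -
  interpret pair_graph G by fact
  obtain hom where hom: "pre_digraph.digraph_isomorphism (with_proj G \<restriction> A_set G) hom"
    and cyc: "with_proj (cycle_graph 5) = app_iso hom (with_proj G \<restriction> A_set G)"
    using assms(2) unfolding type_3_def digraph_iso_def by blast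
  define f where "f = iso_verts hom"
  have inj: "inj_on f (A_set G)"
    using hom by (auto simp: pre_digraph.digraph_isomorphism_def f_def)
  have V: "f ` A_set G = {..<5}"
    using arg_cong[OF cyc, of verts] by (simp add: f_def cycle_graph_def)
  have sub: "A_set G \<subseteq> pverts G" by (auto simp: A_set_def)
  have E: "parcs (cycle_graph 5) = iso_arcs hom ` {e \<in> parcs G. fst e \<in> A_set G \<and> snd e \<in> A_set G}"
    using arg_cong[OF cyc, of arcs] by (simp add: induce_subgraph_def)
  have ends: "iso_tail hom = fst" "iso_head hom = snd"
    using arg_cong[OF cyc, of tail] arg_cong[OF cyc, of head] by (simp_all add: app_iso_def)
  have arc: "iso_arcs hom (u, v) = (f u, f v)" if "(u, v) \<in> parcs G" "u \<in> A_set G" "v \<in> A_set G" for u v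
    using hom that ends
    by (auto simp: pre_digraph.digraph_isomorphism_def f_def induce_subgraph_def intro!: prod_eqI)
  have iff: "(u, v) \<in> parcs G \<longleftrightarrow> (f u, f v) \<in> parcs (cycle_graph 5)"
    if "u \<in> A_set G" "v \<in> A_set G" for u v
  proof
    assume "(u, v) \<in> parcs G"
    then show "(f u, f v) \<in> parcs (cycle_graph 5)" unfolding E using arc that by force
  next
    assume "(f u, f v) \<in> parcs (cycle_graph 5)"
    then obtain x y where xy: "(x, y) \<in> parcs G" "x \<in> A_set G" "y \<in> A_set G"
      "(f u, f v) = iso_arcs hom (x, y)"
      unfolding E by auto
    then have "f u = f x" "f v = f y" using arc by auto
    then have "u = x" "v = y" using inj that xy by (meson inj_onD)+
    then show "(u, v) \<in> parcs G" using xy by simp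
  qed
  define p where "p = the_inv_into (A_set G) f"
  have p: "p i \<in> A_set G" "f (p i) = i" if "i < 5" for i
    using that inj V unfolding p_def
    by (auto simp: the_inv_into_into f_the_inv_into_f)
  have bij: "bij_betw p {..<5} (A_set G)"
    unfolding p_def using bij_betw_the_inv_into[of f "A_set G"] inj V by (auto simp: bij_betw_def)
  have "induces_C5 G p"
    using bij sub p unfolding induces_C5_def
    by (auto simp: bij_betw_def iff cycle_graph_def)
  moreover have "p ` {..<5} = A_set G" using bij by (simp add: bij_betw_def)
  ultimately show thesis by (rule that)
qed

text \<open>
  The bounds \<open>\<chi>(G) \<le> |B| + 3\<close> and, dually, \<open>|C| + 3\<close> for the complement add up to exactly the sum
  required of an NG-graph, so both are equalities and \<open>high_degree_part\<close> applies to \<open>G\<close> and to its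
  complement.
\<close>

lemma type_3_NG_graph_split:
  assumes "pair_graph G" "NG_graph G" "type_3 G"
  obtains B C p where "C5_split G B C p"
proof -
  interpret pair_graph G by fact
  let ?H = "complement_graph G"
  interpret H: pair_graph ?H by (rule pair_graph_complement_graph[OF assms(1)])
  obtain p where C5: "induces_C5 G p" and A: "p ` {..<5} = A_set G"
    by (rule type_3_induces_C5[OF assms(1,3)])
  have C5': "induces_C5 ?H (\<lambda>i. p (2 * i mod 5))" and A': "(\<lambda>i. p (2 * i mod 5)) ` {..<5} = A_set G"
    using induces_C5_complement[OF C5] A by auto
  define B where "B = {v \<in> pverts G. chromatic_number G - 1 < card (nbhd G v)}"
  define C where "C = {v \<in> pverts G. card (nbhd G v) < chromatic_number G - 1}"
  have A_eq: "A_set G = {v \<in> pverts G. card (nbhd G v) = chromatic_number G - 1}"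
    by (simp add: A_set_def out_degree_eq_card_nbhd)
  have V: "pverts G = A_set G \<union> B \<union> C" "pverts G = A_set G \<union> C \<union> B"
    and disj: "A_set G \<inter> B = {}" "A_set G \<inter> C = {}" "B \<inter> C = {}"
    by (auto simp: A_eq B_def C_def)
  have fin: "finite B" "finite C" using V(1) pair_finite_verts by auto
  have sum: "chromatic_number G + chromatic_number ?H = card (pverts G) + 1"
    using assms(2) by (simp add: NG_graph_def)
  have low: "card (nbhd G v) < chromatic_number G - 1" if "v \<in> C" for v
    using that by (simp add: C_def)
  \<comment> \<open>Degrees in \<open>G\<close> and in the complement add up to \<open>n - 1\<close>, as do \<open>\<chi> - 1\<close> and its dual, so the
    vertices of high degree in \<open>G\<close> are those of low degree in the complement.\<close>
  have low': "card (nbhd ?H v) < chromatic_number ?H - 1" if "v \<in> B" for v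
    using that card_nbhd_complement[OF assms(1), of v] sum by (auto simp: B_def)
  have "card (A_set G) = 5"
    using C5 by (simp add: induces_C5_def card_image flip: A)
  moreover have "card (A_set G \<union> B) = card (A_set G) + card B"
    using disj fin V(1) pair_finite_verts by (intro card_Un_disjoint) auto
  moreover have "card (A_set G \<union> B \<union> C) = card (A_set G \<union> B) + card C"
    using disj fin V(1) pair_finite_verts by (intro card_Un_disjoint) auto
  ultimately have n: "card (pverts G) = 5 + card B + card C" by (simp add: V(1))
  note high = high_degree_part[where C = C, OF assms(1) C5, unfolded A, OF V(1) disj(1) low]
  note high' = high_degree_part[where C = B, OF H.pair_graph_axioms C5', unfolded A' pverts_complement,
      OF V(2) disj(2) low']
  have chi: "chromatic_number G = card B + 3" "chromatic_number ?H = card C + 3"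
    using high(1) high'(1) sum n by auto
  have "(x, y) \<notin> parcs G" if "x \<in> C" "y \<in> A_set G \<union> C" for x y
  proof (cases "x = y")
    case True
    then show ?thesis using no_loops' by blast
  next
    case False
    then show ?thesis using high'(2)[OF _ chi(2) that] by (simp add: parcs_complement_iff)
  qed
  then have "C5_split G B C p"
    using C5 V(1) disj high(2)[OF _ chi(1)] by unfold_locales (simp_all add: A)
  then show thesis by (rule that)
qed

theorem theorem4p4:
  fixes G :: "'a pair_pre_digraph"
  assumes "pair_graph G"
    and "NG_graph G"
    and "type_3 G"
  shows "\<not> NGD_graph G"
proof -
  obtain B C p where "C5_split G B C p"
    by (rule type_3_NG_graph_split[OF assms])
  then show ?thesis by (rule C5_split.not_NGD_graph)
qed

end
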